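(* Let $k\ge1$ be an integer and let $H=(V,E)$ be a $(k+1)$-uniform hypergraph. (i) If $k$ is odd, then $$T_{\mathrm{HG}}(H;x+1,y+1)=\sum_{A\subseteq E}T_{\mathrm{HG}}(H|_A;0,y+1)\,T_{\mathrm{HG}}(H/A;x+1,0).$$ (ii) If $k$ is even, then both $$T_{\mathrm{HG}}(H;x+1,y+1)=\sum_{A\subseteq E}(-1)^{v(H)-\kappa_H(A)}\,\chi^*(H|_A;-y)\,T_{\mathrm{HG}}(H/A;x+1,0)$$ and $$T_{\mathrm{HG}}(H;x+1,y+1)=\sum_{A\subseteq E}(-1)^{v(H/A)-\kappa(H/A)}\,T_{\mathrm{HG}}(H|_A;0,y+1)\,\chi(H/A;-x).$$
   Context: A hypergraph is a pair $H=(V,E)$ where $V$ is a finite set and $E$ is a finite multiset (parallel hyperedges are allowed and treated as distinct elements of $E$) of multisets of elements of $V$, called hyperedges. For $e\in E$, $d(e)$ is the size of $e$ counted with multiplicity; it is always assumed that $d(e)>1$. $H$ is $(k+1)$-uniform if $d(e)=k+1$ for all $e\in E$. Write $v(H)=|V|$. $\kappa(H)$ is the number of connected components of the bipartite incidence graph with vertex classes $V$ and $E$, in which $u\in V$ and $e\in E$ are joined by as many edges as the multiplicity of $u$ in $e$. For $A\subseteq E$ let $H|_A=(V,A)$, $\kappa(A)=\kappa_H(A)=\kappa(H|_A)$, $d(A)=\sum_{e\in A}d(e)$, and $|A|$ is the number of hyperedges in $A$. Hypergraph Tutte polynomial: $T_{\mathrm{HG}}(H;x,y)=\sum_{A\subseteq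 E}(x-1)^{\kappa(A)-\kappa(H)}(y-1)^{d(A)-|A|-v(H)+\kappa(A)}$. Contraction of a hyperedge: $H/e=(V',E')$ with $V'=(V\setminus e)\cup\{v_e\}$ (all vertices occurring in $e$ are removed and one new vertex $v_e$ is added) and $E'=\{f':f\in E\setminus\{e\}\}$, where $f'$ is obtained from $f$ by replacing every occurrence (with multiplicity) of a vertex of $e$ by $v_e$. For $A\subseteq E$, $H/A$ is the hypergraph (well defined up to isomorphism) obtained by successively contracting the hyperedges of $A$. For a $(k+1)$-uniform hypergraph $H=(V,E)$: $\chi(H;x)=\sum_{B\subseteq E}(-1)^{|B|}x^{\kappa(B)-\kappa(H)}$ and $\chi^*(H;x)=\sum_{B\subseteq E}(-1)^{|B|}x^{k(|E|-|B|)-v(H)+\kappa(E\setminus B)}$. *)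

theory Defs
  imports "HOL-Library.Multiset"
begin

text \<open>
  Parallel hyperedges are distinct, so the multiset of hyperedges is encoded as a set of
  labels, each carrying the multiset of its vertices.
\<close>

record ('a, 'e) pre_hypergraph =
  verts :: "'a set"
  edges :: "'e set"
  ends :: "'e \<Rightarrow> 'a multiset"

locale hypergraph =
  fixes H :: "('a, 'e) pre_hypergraph"
  assumes finite_verts: "finite (verts H)"
    and finite_edges: "finite (edges H)"
    and ends_in_verts: "\<And>e. e \<in> edges H \<Longrightarrow> set_mset (ends H e) \<subseteq> verts H"
    and size_ends_gt_1: "\<And>e. e \<in> edges H \<Longrightarrow> size (ends H e) > 1"

definition uniform :: "nat \<Rightarrow> ('a, 'e) pre_hypergraph \<Rightarrow> bool" where
  "uniform r H \<longleftrightarrow> (\<forall>e\<in>edges H. size (ends H e) = r)"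

definition num_verts :: "('a, 'e) pre_hypergraph \<Rightarrow> nat" where
  "num_verts H = card (verts H)"

definition deg_sum :: "('a, 'e) pre_hypergraph \<Rightarrow> 'e set \<Rightarrow> nat" where
  "deg_sum H A = (\<Sum>e\<in>A. size (ends H e))"

definition restrict_edges :: "('a, 'e) pre_hypergraph \<Rightarrow> 'e set \<Rightarrow> ('a, 'e) pre_hypergraph" where
  "restrict_edges H A = H\<lparr>edges := A\<rparr>"

text \<open>
  Adjacency in the bipartite incidence graph on the disjoint union of vertices and hyperedges.
  Only adjacency is recorded, since the number of parallel incidence edges does not affect
  connectedness.
\<close>

definition incidence :: "('a, 'e) pre_hypergraph \<Rightarrow> (('a + 'e) \<times> ('a + 'e)) set" where
  "incidence H = {(Inl u, Inr e) |u e. e \<in> edges H \<and> u \<in># ends H e}"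

definition components :: "('a, 'e) pre_hypergraph \<Rightarrow> ('a + 'e) set set" where
  "components H = (verts H <+> edges H) // (incidence H \<union> (incidence H)\<inverse>)\<^sup>*"

definition num_comps :: "('a, 'e) pre_hypergraph \<Rightarrow> nat" where
  "num_comps H = card (components H)"

definition num_comps_on :: "('a, 'e) pre_hypergraph \<Rightarrow> 'e set \<Rightarrow> nat" where
  "num_comps_on H A = num_comps (restrict_edges H A)"

text \<open>
  In a hypergraph, adding a hyperedge of size \<open>d\<close> lowers the number of components by at
  least \<open>0\<close> and at most \<open>d - 1\<close>. Hence none of the subtractions in the exponents below
  truncates. Sums are grouped before subtracting so that no intermediate result is negative.
\<close>

definition tutte_HG :: "('a, 'e) pre_hypergraph \<Rightarrow> 'r::comm_ring_1 \<Rightarrow> 'r \<Rightarrow> 'r" where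
  "tutte_HG H x y =
     (\<Sum>A\<in>Pow (edges H).
        (x - 1) ^ (num_comps_on H A - num_comps H) *
        (y - 1) ^ ((deg_sum H A + num_comps_on H A) - (card A + num_verts H)))"

definition chi :: "('a, 'e) pre_hypergraph \<Rightarrow> 'r::comm_ring_1 \<Rightarrow> 'r" where
  "chi H x = (\<Sum>B\<in>Pow (edges H). (- 1) ^ card B * x ^ (num_comps_on H B - num_comps H))"

text \<open>Here \<open>k\<close> is the parameter for which the hypergraph is \<open>(k + 1)\<close>-uniform.\<close>

definition chi_star :: "nat \<Rightarrow> ('a, 'e) pre_hypergraph \<Rightarrow> 'r::comm_ring_1 \<Rightarrow> 'r" where
  "chi_star k H x =
     (\<Sum>B\<in>Pow (edges H). (- 1) ^ card B *
        x ^ ((k * (card (edges H) - card B) + num_comps_on H (edges H - B)) - num_verts H))"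

definition contract_edge ::
    "('a, 'e) pre_hypergraph \<Rightarrow> 'e \<Rightarrow> 'a \<Rightarrow> ('a, 'e) pre_hypergraph" where
  "contract_edge H e v =
     \<lparr>verts = (verts H - set_mset (ends H e)) \<union> {v},
      edges = edges H - {e},
      ends = (\<lambda>f. image_mset (\<lambda>u. if u \<in># ends H e then v else u) (ends H f))\<rparr>"

text \<open>
  \<open>contraction H A K\<close>: the hypergraph \<open>K\<close> results from \<open>H\<close> by contracting the hyperedges
  of \<open>A\<close> successively, in some order and with some choice of the new vertices. The new vertex
  must differ from all remaining vertices; the name of a removed vertex may be reused, so that
  contractions exist over every vertex type.
\<close>

inductive contraction ::
    "('a, 'e) pre_hypergraph \<Rightarrow> 'e set \<Rightarrow> ('a, 'e) pre_hypergraph \<Rightarrow> bool" where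
  empty: "contraction H {} H"
| step: "e \<in> A \<Longrightarrow> e \<in> edges H \<Longrightarrow> v \<notin> verts H - set_mset (ends H e) \<Longrightarrow>
    contraction (contract_edge H e v) (A - {e}) K \<Longrightarrow> contraction H A K"

lemma hypergraph_contract_edge:
  assumes "hypergraph H" "e \<in> edges H"
  shows "hypergraph (contract_edge H e v)"
proof -
  interpret hypergraph H by fact
  show ?thesis
  proof
    show "finite (verts (contract_edge H e v))" "finite (edges (contract_edge H e v))"
      using finite_verts finite_edges by (simp_all add: contract_edge_def)
  next
    fix f assume "f \<in> edges (contract_edge H e v)"
    then have f: "f \<in> edges H" by (simp add: contract_edge_def)
    show "set_mset (ends (contract_edge H e v) f) \<subseteq> verts (contract_edge H e v)"
      using ends_in_verts[OF f] by (auto simp: contract_edge_def)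
    show "size (ends (contract_edge H e v) f) > 1"
      using size_ends_gt_1[OF f] by (simp add: contract_edge_def)
  qed
qed

lemma contraction_exists:
  assumes "hypergraph H" "A \<subseteq> edges H"
  shows "\<exists>K. contraction H A K"
proof -
  have "finite A"
    by (rule finite_subset[OF assms(2) hypergraph.finite_edges[OF assms(1)]])
  then show ?thesis
    using assms
  proof (induction A arbitrary: H rule: finite_induct)
    case empty
    show ?case by (rule exI, rule contraction.empty)
  next
    case (insert e A)
    then have e: "e \<in> edges H" by simp
    then have "size (ends H e) > 1"
      by (rule hypergraph.size_ends_gt_1[OF insert.prems(1)])
    then have "ends H e \<noteq> {#}" by auto
    then obtain v where v: "v \<in># ends H e"
      using multiset_nonemptyE by blast
    have "A \<subseteq> edges (contract_edge H e v)"
      using insert by (auto simp: contract_edge_def)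
    then obtain K where "contraction (contract_edge H e v) A K"
      using insert.IH[OF hypergraph_contract_edge[OF insert.prems(1) e]] by metis
    then have "contraction H (insert e A) K"
      using insert.hyps e v contraction.step[of e "insert e A" H v K] by simp
    then show ?case ..
  qed
qed

end

theory Submission
  imports Defs
begin

text \<open>
  Contracting a hyperedge does not change the number of components, and contracting all hyperedges
  of a set \<open>A\<close> leaves one vertex per component of \<open>H|\<^sub>A\<close>. So \<open>v(H/A) = \<kappa>(A)\<close> and
  \<open>\<kappa>\<^bsub>H/A\<^esub>(C) = \<kappa>(A \<union> C)\<close>. Each right-hand side thereby becomes a sum over chains
  \<open>B \<subseteq> A \<subseteq> D\<close>, where \<open>D = A \<union> C\<close>. The signs combine so that \<open>A\<close> enters the
  summand only through \<open>(-1)\<^bsup>|D - A|\<^esup>\<close>, so the sum over \<open>A\<close> vanishes unless \<open>B = D\<close>.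
\<close>

section \<open>Components under contraction\<close>

text \<open>Both images are in bijection with the quotient of \<open>N\<close> by the common kernel.
  This compares the components of a hypergraph and of its contraction when both are indexed by the
  same nodes.\<close>

lemma card_image_eq_of_same_kernel:
  assumes "\<And>x y. x \<in> N \<Longrightarrow> y \<in> N \<Longrightarrow> f x = f y \<longleftrightarrow> g x = g y"
  shows "card (f ` N) = card (g ` N)"
proof -
  have "bij_betw (\<lambda>c. g (SOME x. x \<in> N \<and> f x = c)) (f ` N) (g ` N)"
  proof (rule bij_betw_imageI)
    have some: "(SOME z. z \<in> N \<and> f z = f x) \<in> N \<and> f (SOME z. z \<in> N \<and> f z = f x) = f x"
      if "x \<in> N" for x
      using that by (intro someI_ex[where P = "\<lambda>z. z \<in> N \<and> f z = f x"]) blast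
    then have g: "g (SOME z. z \<in> N \<and> f z = f x) = g x" if "x \<in> N" for x
      using that assms by blast
    show "inj_on (\<lambda>c. g (SOME x. x \<in> N \<and> f x = c)) (f ` N)"
      using g assms by (auto simp: inj_on_def)
    show "(\<lambda>c. g (SOME x. x \<in> N \<and> f x = c)) ` f ` N = g ` N"
      using g by (force simp: image_image)
  qed
  then show ?thesis by (rule bij_betw_same_card)
qed

text \<open>Reflexive on the whole sum type rather than only on the nodes of \<open>H\<close>, so it
  is an equivalence on \<open>UNIV\<close> and needs no membership side conditions.\<close>

definition connected_rel :: "('a, 'e) pre_hypergraph \<Rightarrow> (('a + 'e) \<times> ('a + 'e)) set" where
  "connected_rel H = (incidence H \<union> (incidence H)\<inverse>)\<^sup>*"

lemma equiv_connected_rel: "equiv UNIV (connected_rel H)"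
  unfolding connected_rel_def
  by (intro equivI refl_rtrancl sym_rtrancl trans_rtrancl sym_Un_converse) auto

lemma connected_rel_sym: "(x, y) \<in> connected_rel H \<Longrightarrow> (y, x) \<in> connected_rel H"
  using equiv_connected_rel by (metis equiv_def symE)

lemma connected_rel_trans:
  "(x, y) \<in> connected_rel H \<Longrightarrow> (y, z) \<in> connected_rel H \<Longrightarrow> (x, z) \<in> connected_rel H"
  unfolding connected_rel_def by (rule rtrancl_trans)

lemma connected_rel_incident:
  "e \<in> edges H \<Longrightarrow> u \<in># ends H e \<Longrightarrow> (Inl u, Inr e) \<in> connected_rel H"
  unfolding connected_rel_def by (auto simp: incidence_def)

text \<open>Walks are mapped step by step. The map \<open>h\<close> may send a hyperedge to a vertex
  or an incidence to a longer walk, so both the collapse of a hyperedge and a section of that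
  collapse qualify.\<close>

lemma connected_rel_lift:
  assumes "\<And>u e. e \<in> edges H \<Longrightarrow> u \<in># ends H e \<Longrightarrow>
      (h (Inl u), h (Inr e)) \<in> connected_rel K"
    and "(x, y) \<in> connected_rel H"
  shows "(h x, h y) \<in> connected_rel K"
  using assms(2) unfolding connected_rel_def[of H]
proof (induction rule: rtrancl_induct)
  case base
  show ?case by (simp add: connected_rel_def)
next
  case (step y z)
  from step(2) have "(h y, h z) \<in> connected_rel K"
    using assms(1) by (auto simp: incidence_def intro: connected_rel_sym)
  with step(3) show ?case by (rule connected_rel_trans)
qed

text \<open>Contraction collapses \<open>e\<close> and its vertices, which already lie in one
  component, to the single node \<open>v\<close>. Hence two nodes are connected before the collapse
  iff their images are connected after it.\<close>

lemma num_comps_contract_edge: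
  assumes "hypergraph H" and e: "e \<in> edges H" and v: "v \<notin> verts H - set_mset (ends H e)"
  shows "num_comps (contract_edge H e v) = num_comps H"
proof -
  interpret hypergraph H by fact
  define K where "K = contract_edge H e v"
  define c where "c = (\<lambda>u. if u \<in># ends H e then v else u)"
  \<comment> \<open>The collapse map on nodes: \<open>e\<close> and all of its vertices go to
    \<open>Inl v\<close>, every other node is fixed.\<close>
  define h :: "'a + 'b \<Rightarrow> 'a + 'b" where
    "h = case_sum (\<lambda>u. Inl (c u)) (\<lambda>f. if f = e then Inl v else Inr f)"
  define N where "N = verts H <+> edges H"
  have edges_K: "edges K = edges H - {e}" and ends_K: "ends K f = image_mset c (ends H f)" for f
    by (auto simp: K_def contract_edge_def c_def)
  have h_N: "h ` N = verts K <+> edges K"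
  proof
    show "h ` N \<subseteq> verts K <+> edges K"
      by (auto simp: N_def h_def K_def contract_edge_def c_def)
    have "Inl u \<in> h ` N" if "u \<in> verts K" for u
    proof (cases "u = v")
      case True
      then have "Inl u = h (Inr e)" by (simp add: h_def)
      then show ?thesis using e by (auto simp: N_def)
    next
      case False
      then have "Inl u = h (Inl u)" "u \<in> verts H"
        using that by (auto simp: h_def c_def K_def contract_edge_def)
      then show ?thesis by (auto simp: N_def)
    qed
    moreover have "Inr f \<in> h ` N" if "f \<in> edges K" for f
    proof -
      have "Inr f = h (Inr f)" "Inr f \<in> N" using that by (auto simp: h_def edges_K N_def)
      then show ?thesis by (rule image_eqI)
    qed
    ultimately show "verts K <+> edges K \<subseteq> h ` N" by auto
  qed
  have fwd: "(h x, h y) \<in> connected_rel K" if "(x, y) \<in> connected_rel H" for x y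
  proof (rule connected_rel_lift[OF _ that])
    fix u f assume f: "f \<in> edges H" "u \<in># ends H f"
    show "(h (Inl u), h (Inr f)) \<in> connected_rel K"
    proof (cases "f = e")
      case True
      then show ?thesis using f by (simp add: h_def c_def connected_rel_def)
    next
      case False
      then show ?thesis using f by (auto simp: h_def edges_K ends_K intro!: connected_rel_incident)
    qed
  qed
  \<comment> \<open>The fibre over \<open>v\<close> contains only \<open>e\<close> and its vertices,
    because \<open>v\<close> is not the name of a remaining vertex. All other fibres are
    singletons.\<close>
  have to_e: "(x, Inr e) \<in> connected_rel H" if "x \<in> N" "h x = Inl v" for x
  proof (cases x)
    case (Inl u)
    then have "u \<in># ends H e"
      using that v by (auto simp: N_def h_def c_def split: if_splits)
    then show ?thesis using Inl e by (auto intro: connected_rel_incident)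
  next
    case (Inr f)
    then show ?thesis using that by (auto simp: h_def connected_rel_def split: if_splits)
  qed
  have fibre: "(x, y) \<in> connected_rel H" if "x \<in> N" "y \<in> N" "h x = h y" for x y
  proof (cases "h x = Inl v")
    case True
    then show ?thesis using that to_e by (metis connected_rel_sym connected_rel_trans)
  next
    case False
    then have "x = y"
      using that(3) by (auto simp: h_def c_def split: sum.splits if_splits)
    then show ?thesis by (simp add: connected_rel_def)
  qed
  have bwd: "(x, y) \<in> connected_rel H"
    if x: "x \<in> N" and y: "y \<in> N" and xy: "(h x, h y) \<in> connected_rel K" for x y
  proof -
    \<comment> \<open>A section of the collapse. \<open>s (h z)\<close> may differ from
      \<open>z\<close> over \<open>v\<close>, but \<open>fibre\<close> connects the two, which
      suffices for lifting walks back to \<open>H\<close>.\<close>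
    define s where "s = inv_into N h"
    have s: "s (h z) \<in> N" "h (s (h z)) = h z" if "z \<in> N" for z
      using that by (auto simp: s_def inv_into_into f_inv_into_f)
    have s_rel: "(s (h z), z) \<in> connected_rel H" if "z \<in> N" for z
      using fibre[OF s(1) that s(2)] that by blast
    have "(s (h x), s (h y)) \<in> connected_rel H"
    proof (rule connected_rel_lift[OF _ xy])
      fix u' f assume "f \<in> edges K" "u' \<in># ends K f"
      then obtain u where u: "u' = c u" "u \<in># ends H f" and f: "f \<in> edges H" "f \<noteq> e"
        by (auto simp: edges_K ends_K)
      have "Inl u' = h (Inl u)" "Inr f = h (Inr f)" "Inl u \<in> N" "Inr f \<in> N"
        using u f ends_in_verts[OF f(1)] by (auto simp: h_def N_def)
      then show "(s (Inl u'), s (Inr f)) \<in> connected_rel H"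
        using s_rel connected_rel_incident[OF f(1) u(2)]
        by (metis connected_rel_sym connected_rel_trans)
    qed
    then show ?thesis
      using s_rel[OF x] s_rel[OF y] by (metis connected_rel_sym connected_rel_trans)
  qed
  \<comment> \<open>Both sets of components are written as images of \<open>N\<close>, so that
    equality of kernels gives equality of cardinalities.\<close>
  have comps: "components H = (\<lambda>x. connected_rel H `` {x}) ` N"
    by (auto simp: components_def quotient_def N_def connected_rel_def)
  have comps': "components K = (\<lambda>x. connected_rel K `` {h x}) ` N"
  proof -
    have "components K = (\<lambda>x. connected_rel K `` {x}) ` (h ` N)"
      unfolding h_N by (auto simp: components_def quotient_def connected_rel_def)
    then show ?thesis by (simp add: image_image)
  qed
  have "connected_rel K `` {h x} = connected_rel K `` {h y} \<longleftrightarrow>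
      connected_rel H `` {x} = connected_rel H `` {y}" if "x \<in> N" "y \<in> N" for x y
    using that fwd bwd by (simp add: eq_equiv_class_iff[OF equiv_connected_rel]) blast
  then have "card (components K) = card (components H)"
    unfolding comps comps' by (rule card_image_eq_of_same_kernel)
  then show ?thesis by (simp add: num_comps_def K_def)
qed

lemma num_comps_no_edges:
  assumes "edges H = {}"
  shows "num_comps H = num_verts H"
proof -
  have "components H = (\<lambda>u. {Inl u}) ` verts H"
    using assms by (auto simp: components_def incidence_def quotient_def)
  then show ?thesis
    by (simp add: num_comps_def num_verts_def card_image inj_on_def)
qed

section \<open>Restriction and iterated contraction\<close>

lemma hypergraph_restrict_edges:
  "hypergraph H \<Longrightarrow> A \<subseteq> edges H \<Longrightarrow> hypergraph (restrict_edges H A)"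
  unfolding hypergraph_def restrict_edges_def by (auto intro: finite_subset)

lemma num_verts_restrict_edges [simp]: "num_verts (restrict_edges H A) = num_verts H"
  and edges_restrict_edges [simp]: "edges (restrict_edges H A) = A"
  and num_comps_on_restrict_edges [simp]: "num_comps_on (restrict_edges H A) B = num_comps_on H B"
  and num_comps_restrict_edges [simp]: "num_comps (restrict_edges H A) = num_comps_on H A"
  by (simp_all add: num_verts_def restrict_edges_def num_comps_on_def)

lemma num_comps_on_edges: "num_comps_on H (edges H) = num_comps H"
  by (simp add: num_comps_on_def restrict_edges_def)

lemma contraction_edges: "contraction H A K \<Longrightarrow> edges K = edges H - A \<and> A \<subseteq> edges H"
  by (induction rule: contraction.induct) (auto simp: contract_edge_def)

lemma contraction_uniform: "contraction H A K \<Longrightarrow> uniform r H \<Longrightarrow> uniform r K"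
  by (induction rule: contraction.induct) (auto simp: contract_edge_def uniform_def)

text \<open>Contracting a hyperedge of \<open>A\<close> commutes with restricting to
  \<open>A \<union> C\<close>, so each contraction step is an instance of the single-hyperedge
  case.\<close>

lemma num_comps_on_contraction:
  assumes "contraction H A K" "hypergraph H" "C \<subseteq> edges K"
  shows "num_comps_on K C = num_comps_on H (A \<union> C)"
  using assms
proof (induction rule: contraction.induct)
  case (empty H)
  then show ?case by simp
next
  case (step e A H v K)
  let ?R = "restrict_edges H (A \<union> C)"
  have e: "e \<notin> C" and AC: "A \<union> C \<subseteq> edges H"
    using step.prems contraction_edges[OF step.hyps(4)] step.hyps(1,2)
    by (auto simp: contract_edge_def)
  then have "restrict_edges (contract_edge H e v) (A - {e} \<union> C) = contract_edge ?R e v"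
    by (auto simp: restrict_edges_def contract_edge_def)
  moreover have "num_comps (contract_edge ?R e v) = num_comps ?R"
    using step.hyps AC hypergraph_restrict_edges[OF step.prems(1) AC]
    by (intro num_comps_contract_edge) (auto simp: restrict_edges_def)
  ultimately show ?case
    using step.IH[OF hypergraph_contract_edge[OF step.prems(1) step.hyps(2)] step.prems(2)]
    by (simp only: num_comps_on_def)
qed

section \<open>Bounds on component counts from vertex counts of contractions\<close>

lemma num_verts_contract_edge:
  assumes "hypergraph H" "e \<in> edges H" "v \<notin> verts H - set_mset (ends H e)"
  shows "num_verts (contract_edge H e v) \<le> num_verts H"
    and "num_verts H + 1 \<le> num_verts (contract_edge H e v) + size (ends H e)"
proof -
  interpret hypergraph H by fact
  let ?S = "set_mset (ends H e)"
  have S: "?S \<subseteq> verts H" by (rule ends_in_verts[OF assms(2)])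
  have "ends H e \<noteq> {#}" using size_ends_gt_1[OF assms(2)] by auto
  \<comment> \<open>The set \<open>?S\<close> of distinct vertices of \<open>e\<close> is replaced
    by one vertex. Its cardinality is at least 1, giving the first bound, and at most the size of
    \<open>e\<close>, giving the second.\<close>
  then have pos: "card ?S > 0" by (simp add: card_gt_0_iff)
  have "card ?S = size (mset_set ?S)" by simp
  also have "\<dots> \<le> size (ends H e)"
    by (intro size_mset_mono) (simp add: mset_set_set_mset_msubset)
  finally have le: "card ?S \<le> size (ends H e)" .
  have "num_verts (contract_edge H e v) = Suc (card (verts H - ?S))"
    using assms(3) finite_verts by (simp add: num_verts_def contract_edge_def)
  moreover have "card (verts H - ?S) + card ?S = num_verts H"
    using card_Diff_subset[OF _ S] card_mono[OF finite_verts S] by (simp add: num_verts_def)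
  ultimately show "num_verts (contract_edge H e v) \<le> num_verts H"
    and "num_verts H + 1 \<le> num_verts (contract_edge H e v) + size (ends H e)"
    using pos le by auto
qed

lemma num_verts_contraction:
  assumes "contraction H A K" "hypergraph H"
  shows "num_verts K \<le> num_verts H"
    and "uniform (k + 1) H \<Longrightarrow> num_verts H \<le> num_verts K + k * card A"
proof -
  have "num_verts K \<le> num_verts H \<and>
      (uniform (k + 1) H \<longrightarrow> num_verts H \<le> num_verts K + k * card A)"
    using assms
  proof (induction rule: contraction.induct)
    case (empty H)
    then show ?case by simp
  next
    case (step e A H v K)
    have "A \<subseteq> edges H"
      using contraction_edges[OF step.hyps(4)] step.hyps(1,2) by (auto simp: contract_edge_def)
    then have "finite A"
      using hypergraph.finite_edges[OF step.prems] finite_subset by blast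
    then have card: "card A = Suc (card (A - {e}))"
      using step.hyps(1) by (rule card.remove)
    note IH = step.IH[OF hypergraph_contract_edge[OF step.prems step.hyps(2)]]
    note nv = num_verts_contract_edge[OF step.prems step.hyps(2,3)]
    have "uniform (k + 1) (contract_edge H e v) \<and> size (ends H e) = k + 1"
      if "uniform (k + 1) H"
      using that step.hyps(2) by (auto simp: uniform_def contract_edge_def)
    then show ?case using IH nv by (auto simp: card)
  qed
  then show "num_verts K \<le> num_verts H"
    and "uniform (k + 1) H \<Longrightarrow> num_verts H \<le> num_verts K + k * card A" by auto
qed

text \<open>Without hyperedges, every vertex of \<open>K\<close> is a component of its own; the case
  \<open>C = {}\<close> of the component count for contractions then applies.\<close>

lemma num_verts_contraction_eq:
  assumes "contraction H A K" "hypergraph H"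
  shows "num_verts K = num_comps_on H A"
  using num_comps_on_contraction[OF assms, of "{}"] num_comps_no_edges[of "restrict_edges K {}"]
  by simp

lemma num_comps_on_le_num_verts:
  assumes "hypergraph H" "A \<subseteq> edges H"
  shows "num_comps_on H A \<le> num_verts H"
  using contraction_exists[OF assms] num_verts_contraction(1) num_verts_contraction_eq assms(1)
  by metis

lemma num_verts_le_num_comps_on:
  assumes "hypergraph H" "A \<subseteq> edges H" "uniform (k + 1) H"
  shows "num_verts H \<le> num_comps_on H A + k * card A"
  using contraction_exists[OF assms(1,2)] num_verts_contraction(2) num_verts_contraction_eq
    assms(1,3) by metis

lemma hypergraph_contraction: "contraction H A K \<Longrightarrow> hypergraph H \<Longrightarrow> hypergraph K"
  by (induction rule: contraction.induct) (auto intro: hypergraph_contract_edge)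

text \<open>Contract \<open>A\<close> to get \<open>K\<close>: the left side counts components of
  \<open>K\<close> with hyperedges \<open>B - A\<close>, the right side counts its vertices.\<close>

lemma num_comps_on_antimono:
  assumes "hypergraph H" "A \<subseteq> B" "B \<subseteq> edges H"
  shows "num_comps_on H B \<le> num_comps_on H A"
proof -
  have "A \<subseteq> edges H" using assms by blast
  from contraction_exists[OF assms(1) this] obtain K where K: "contraction H A K" ..
  have BA: "B - A \<subseteq> edges K" using contraction_edges[OF K] assms(3) by blast
  have "num_comps_on H B = num_comps_on K (B - A)"
    using num_comps_on_contraction[OF K assms(1) BA] assms(2) by (simp add: Un_absorb1)
  also have "\<dots> \<le> num_verts K"
    by (rule num_comps_on_le_num_verts[OF hypergraph_contraction[OF K assms(1)] BA])
  also have "\<dots> = num_comps_on H A" by (rule num_verts_contraction_eq[OF K assms(1)])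
  finally show ?thesis .
qed

lemma deg_sum_uniform:
  "uniform r H \<Longrightarrow> A \<subseteq> edges H \<Longrightarrow> deg_sum H A = r * card A"
  unfolding deg_sum_def uniform_def by (subst sum.cong[OF refl, of _ _ "\<lambda>_. r"]) auto

section \<open>Alternating sums over chains\<close>

text \<open>For a fixed element \<open>a\<close> of \<open>S\<close>, the subsets without
  \<open>a\<close> cancel against the same subsets with \<open>a\<close> inserted.\<close>

lemma sum_Pow_neg_one_power_card:
  assumes "finite S"
  shows "(\<Sum>X\<in>Pow S. (- 1) ^ card X :: 'r::comm_ring_1) = (if S = {} then 1 else 0)"
proof (cases "S = {}")
  case False
  then obtain a T where S: "S = insert a T" "a \<notin> T" by (meson ex_in_conv mk_disjoint_insert)
  with assms have T: "finite T" by simp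
  have "(\<Sum>X\<in>Pow S. (- 1) ^ card X :: 'r) =
      (\<Sum>X\<in>Pow T. (- 1) ^ card X) + (\<Sum>X\<in>insert a ` Pow T. (- 1) ^ card X)"
    unfolding S(1) Pow_insert using T S(2) by (intro sum.union_disjoint) auto
  also have "(\<Sum>X\<in>insert a ` Pow T. (- 1) ^ card X :: 'r) = (\<Sum>X\<in>Pow T. (- 1) ^ card (insert a X))"
    using S(2) by (intro sum.reindex[unfolded o_def]) (auto simp: inj_on_def)
  also have "\<dots> = (\<Sum>X\<in>Pow T. - ((- 1) ^ card X))"
    using S(2) T by (intro sum.cong refl, subst card_insert_disjoint) (auto intro: finite_subset)
  finally show ?thesis using False by (simp add: sum_negf)
qed simp

lemma sum_interval_neg_one_power_card:
  assumes "finite D" "B \<subseteq> D"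
  shows "(\<Sum>A | B \<subseteq> A \<and> A \<subseteq> D. (- 1) ^ card (D - A) :: 'r::comm_ring_1) = (if B = D then 1 else 0)"
proof -
  have "(\<Sum>A | B \<subseteq> A \<and> A \<subseteq> D. (- 1) ^ card (D - A) :: 'r) = (\<Sum>X\<in>Pow (D - B). (- 1) ^ card X)"
    using assms by (intro sum.reindex_bij_witness[of _ "\<lambda>X. D - X" "\<lambda>A. D - A"]) auto
  also have "\<dots> = (if B = D then 1 else 0)"
    using assms by (subst sum_Pow_neg_one_power_card) auto
  finally show ?thesis .
qed

text \<open>\<open>p A B\<close> and \<open>q A C\<close> stand for the summands of the factors
  belonging to the restriction to \<open>A\<close> and to the contraction of \<open>A\<close>. The
  hypothesis on them leaves \<open>A\<close> only in a sign, so summing over \<open>A\<close> first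
  kills all terms with \<open>B \<noteq> D\<close>.\<close>

lemma sum_chains_collapse:
  fixes p q s :: "'e set \<Rightarrow> 'e set \<Rightarrow> 'r::comm_ring_1"
  assumes E: "finite E"
    and pq: "\<And>B A D. B \<subseteq> A \<Longrightarrow> A \<subseteq> D \<Longrightarrow> D \<subseteq> E \<Longrightarrow> p A B * q A (D - A) = s B D * (- 1) ^ card (D - A)"
  shows "(\<Sum>A\<in>Pow E. (\<Sum>B\<in>Pow A. p A B) * (\<Sum>C\<in>Pow (E - A). q A C)) = (\<Sum>D\<in>Pow E. s D D)"
proof -
  have "(\<Sum>A\<in>Pow E. (\<Sum>B\<in>Pow A. p A B) * (\<Sum>C\<in>Pow (E - A). q A C)) =
      (\<Sum>A\<in>Pow E. \<Sum>D | A \<subseteq> D \<and> D \<subseteq> E. \<Sum>B\<in>Pow A. s B D * (- 1) ^ card (D - A))"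
  proof (intro sum.cong refl)
    fix A assume A: "A \<in> Pow E"
    \<comment> \<open>Substitute \<open>D = A \<union> C\<close>.\<close>
    have "(\<Sum>C\<in>Pow (E - A). q A C) = (\<Sum>D | A \<subseteq> D \<and> D \<subseteq> E. q A (D - A))"
      using A by (intro sum.reindex_bij_witness[of _ "\<lambda>D. D - A" "\<lambda>C. A \<union> C"])
        (auto intro!: arg_cong[where f = "q A"])
    then have "(\<Sum>B\<in>Pow A. p A B) * (\<Sum>C\<in>Pow (E - A). q A C) =
        (\<Sum>D | A \<subseteq> D \<and> D \<subseteq> E. \<Sum>B\<in>Pow A. p A B * q A (D - A))"
      by (simp add: sum_distrib_left sum_distrib_right)
    also have "\<dots> = (\<Sum>D | A \<subseteq> D \<and> D \<subseteq> E. \<Sum>B\<in>Pow A. s B D * (- 1) ^ card (D - A))"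
      using pq by (intro sum.cong refl) auto
    finally show "(\<Sum>B\<in>Pow A. p A B) * (\<Sum>C\<in>Pow (E - A). q A C) = \<dots>" .
  qed
  also have "\<dots> = (\<Sum>D\<in>Pow E. \<Sum>A\<in>Pow D. \<Sum>B\<in>Pow A. s B D * (- 1) ^ card (D - A))"
  proof -
    have "(\<Sum>A\<in>Pow E. \<Sum>D | D \<in> Pow E \<and> A \<subseteq> D. F A D) = (\<Sum>D\<in>Pow E. \<Sum>A | A \<in> Pow E \<and> A \<subseteq> D. F A D)"
      for F :: "'e set \<Rightarrow> 'e set \<Rightarrow> 'r"
      using E by (intro sum.swap_restrict) auto
    moreover have "{D. D \<in> Pow E \<and> A \<subseteq> D} = {D. A \<subseteq> D \<and> D \<subseteq> E}" for A by auto
    moreover have "{A. A \<in> Pow E \<and> A \<subseteq> D} = Pow D" if "D \<in> Pow E" for D using that by auto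
    ultimately show ?thesis by simp
  qed
  \<comment> \<open>A second exchange makes the sum over \<open>A\<close> innermost, where it is an
    alternating sum over an interval.\<close>
  also have "\<dots> = (\<Sum>D\<in>Pow E. \<Sum>B\<in>Pow D. \<Sum>A | B \<subseteq> A \<and> A \<subseteq> D. s B D * (- 1) ^ card (D - A))"
  proof (rule sum.cong[OF refl])
    fix D assume "D \<in> Pow E"
    then have D: "finite D" using E finite_subset by auto
    have "(\<Sum>A\<in>Pow D. \<Sum>B | B \<in> Pow D \<and> B \<subseteq> A. F A B) = (\<Sum>B\<in>Pow D. \<Sum>A | A \<in> Pow D \<and> B \<subseteq> A. F A B)"
      for F :: "'e set \<Rightarrow> 'e set \<Rightarrow> 'r"
      using D by (intro sum.swap_restrict) auto
    moreover have "{A. A \<in> Pow D \<and> B \<subseteq> A} = {A. B \<subseteq> A \<and> A \<subseteq> D}" for B by auto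
    moreover have "{B. B \<in> Pow D \<and> B \<subseteq> A} = Pow A" if "A \<in> Pow D" for A using that by auto
    ultimately show "(\<Sum>A\<in>Pow D. \<Sum>B\<in>Pow A. s B D * (- 1) ^ card (D - A)) =
        (\<Sum>B\<in>Pow D. \<Sum>A | B \<subseteq> A \<and> A \<subseteq> D. s B D * (- 1) ^ card (D - A))" by simp
  qed
  also have "\<dots> = (\<Sum>D\<in>Pow E. \<Sum>B\<in>Pow D. if B = D then s B D else 0)"
  proof (intro sum.cong refl)
    fix D B assume DB: "D \<in> Pow E" "B \<in> Pow D"
    then have "finite D" using E finite_subset by auto
    with DB show "(\<Sum>A | B \<subseteq> A \<and> A \<subseteq> D. s B D * (- 1) ^ card (D - A)) = (if B = D then s B D else 0)"
      by (simp add: sum_distrib_left[symmetric] sum_interval_neg_one_power_card)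
  qed
  also have "\<dots> = (\<Sum>D\<in>Pow E. s D D)"
    using E by (intro sum.cong refl) (auto dest: finite_subset simp: sum.delta)
  finally show ?thesis .
qed

section \<open>The convolution formulas\<close>

lemma neg_one_power_cong: "even m = even n \<Longrightarrow> (- 1 :: 'r::comm_ring_1) ^ m = (- 1) ^ n"
  by (simp add: minus_one_power_iff)

lemma tutte_HG_uniform:
  assumes "uniform (k + 1) H"
  shows "tutte_HG H x y = (\<Sum>A\<in>Pow (edges H).
     (x - 1) ^ (num_comps_on H A - num_comps H) *
     (y - 1) ^ (k * card A + num_comps_on H A - num_verts H))"
  unfolding tutte_HG_def
  by (intro sum.cong refl) (simp add: deg_sum_uniform[OF assms] algebra_simps)

text \<open>Passing to complements makes the exponent of \<open>x\<close> the one that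
  \<open>y - 1\<close> carries in the Tutte polynomial of a uniform hypergraph.\<close>

lemma chi_star_alt:
  assumes "finite (edges H)"
  shows "chi_star k H x = (\<Sum>B\<in>Pow (edges H). (- 1) ^ card (edges H - B) *
     x ^ (k * card B + num_comps_on H B - num_verts H))"
  unfolding chi_star_def
proof (rule sum.reindex_bij_witness[of _ "\<lambda>B. edges H - B" "\<lambda>B. edges H - B"])
  fix B assume B: "B \<in> Pow (edges H)"
  then have "card (edges H - B) = card (edges H) - card B" "edges H - (edges H - B) = B"
    using assms by (auto simp: card_Diff_subset finite_subset)
  then show "(- 1) ^ card (edges H - (edges H - B)) *
      x ^ (k * card (edges H - B) + num_comps_on H (edges H - B) - num_verts H) =
      (- 1) ^ card B * x ^ (k * (card (edges H) - card B) + num_comps_on H (edges H - B) - num_verts H)"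
    by simp
qed auto

text \<open>Since H/A is determined only up to isomorphism, \<open>H_contr\<close> is an arbitrary
  choice of a contraction for each \<open>A\<close>; such choices exist by
  \<open>contraction_exists\<close>.\<close>

theorem theorem4p10:
  fixes k :: nat
    and H :: "('a, 'e) pre_hypergraph"
    and H_contr :: "'e set \<Rightarrow> ('a, 'e) pre_hypergraph"
    and x y :: "'r::comm_ring_1"
  assumes "k \<ge> 1"
    and "hypergraph H"
    and "uniform (k + 1) H"
    and "\<And>A. A \<subseteq> edges H \<Longrightarrow> contraction H A (H_contr A)"
  shows "(odd k \<longrightarrow>
           tutte_HG H (x + 1) (y + 1) =
             (\<Sum>A\<in>Pow (edges H).
                tutte_HG (restrict_edges H A) 0 (y + 1) * tutte_HG (H_contr A) (x + 1) 0)) \<and>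
         (even k \<longrightarrow>
           tutte_HG H (x + 1) (y + 1) =
             (\<Sum>A\<in>Pow (edges H).
                (- 1) ^ (num_verts H - num_comps_on H A) *
                chi_star k (restrict_edges H A) (- y) * tutte_HG (H_contr A) (x + 1) 0) \<and>
           tutte_HG H (x + 1) (y + 1) =
             (\<Sum>A\<in>Pow (edges H).
                (- 1) ^ (num_verts (H_contr A) - num_comps (H_contr A)) *
                tutte_HG (restrict_edges H A) 0 (y + 1) * chi (H_contr A) (- x)))"
proof -
  interpret hypergraph H by fact
  define E where "E = edges H"
  define \<kappa> where "\<kappa> = num_comps_on H"
  define nv where "nv = num_verts H"
  define r where "r = (\<lambda>D. \<kappa> D - \<kappa> E)"
  define n where "n = (\<lambda>B. k * card B + \<kappa> B - nv)"
  \<comment> \<open>The part of a chain's summand that is independent of \<open>A\<close>. For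
    \<open>B = D\<close> the sign is even, which leaves exactly the Tutte summand of
    \<open>D\<close>.\<close>
  define s where "s = (\<lambda>B D. x ^ r D * y ^ n B * (- 1) ^ (\<kappa> B + \<kappa> D))"
  note unif = assms(3) and contr = assms(4)[folded E_def]
  have fin: "finite E" by (simp add: E_def finite_edges)
  have \<kappa>_mono: "\<kappa> B \<le> \<kappa> A" if "A \<subseteq> B" "B \<subseteq> E" for A B
    using num_comps_on_antimono[OF assms(2)] that by (simp add: \<kappa>_def E_def)
  have \<kappa>_le: "\<kappa> A \<le> nv" and nv_le: "nv \<le> \<kappa> A + k * card A" if "A \<subseteq> E" for A
    using num_comps_on_le_num_verts[OF assms(2)] num_verts_le_num_comps_on[OF assms(2) _ unif] that
    by (auto simp: \<kappa>_def E_def nv_def)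
  have T: "tutte_HG H (x + 1) (y + 1) = (\<Sum>D\<in>Pow E. s D D)"
    by (simp add: tutte_HG_uniform[OF unif] s_def r_def n_def \<kappa>_def E_def nv_def num_comps_on_edges)
  have T_restr: "tutte_HG (restrict_edges H A) 0 (y + 1) =
      (\<Sum>B\<in>Pow A. (- 1) ^ (\<kappa> B - \<kappa> A) * y ^ n B)" if "A \<subseteq> E" for A
  proof -
    have "uniform (k + 1) (restrict_edges H A)"
      using unif that by (auto simp: uniform_def restrict_edges_def E_def)
    from tutte_HG_uniform[OF this, of 0 "y + 1"] show ?thesis
      by (simp add: n_def \<kappa>_def nv_def)
  qed
  have chi_star_restr: "chi_star k (restrict_edges H A) (- y) =
      (\<Sum>B\<in>Pow A. (- 1) ^ card (A - B) * (- y) ^ n B)" if "A \<subseteq> E" for A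
    using finite_subset[OF that fin] by (simp add: chi_star_alt n_def \<kappa>_def nv_def)
  have edges_contr: "edges (H_contr A) = E - A"
    and nv_contr: "num_verts (H_contr A) = \<kappa> A"
    and \<kappa>_contr: "num_comps_on (H_contr A) C = \<kappa> (A \<union> C)"
    and \<kappa>_contr_E: "num_comps (H_contr A) = \<kappa> E" if "A \<subseteq> E" "C \<subseteq> E - A" for A C
  proof -
    show edges: "edges (H_contr A) = E - A" using contraction_edges[OF contr[OF that(1)]]
      by (simp add: E_def)
    show "num_verts (H_contr A) = \<kappa> A"
      using num_verts_contraction_eq[OF contr[OF that(1)] assms(2)] by (simp add: \<kappa>_def)
    have *: "num_comps_on (H_contr A) C = \<kappa> (A \<union> C)" if "C \<subseteq> E - A" for C
      using num_comps_on_contraction[OF contr[OF \<open>A \<subseteq> E\<close>] assms(2)] that edges by (simp add: \<kappa>_def)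
    show "num_comps_on (H_contr A) C = \<kappa> (A \<union> C)" by (rule *[OF that(2)])
    \<comment> \<open>Here \<open>*\<close> is used for \<open>E - A\<close>, the set of all
      hyperedges of the contraction.\<close>
    show "num_comps (H_contr A) = \<kappa> E"
      using *[OF order_refl] num_comps_on_edges[of "H_contr A"] that(1) edges
      by (simp add: Un_absorb1)
  qed
  have T_contr: "tutte_HG (H_contr A) (x + 1) 0 =
      (\<Sum>C\<in>Pow (E - A). x ^ r (A \<union> C) * (- 1) ^ (k * card C + \<kappa> (A \<union> C) - \<kappa> A))" if A: "A \<subseteq> E" for A
    unfolding tutte_HG_uniform[OF contraction_uniform[OF contr[OF A] unif]]
      edges_contr[OF A empty_subsetI] nv_contr[OF A empty_subsetI] \<kappa>_contr_E[OF A empty_subsetI]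
    using \<kappa>_contr[OF A] by (intro sum.cong refl) (simp add: r_def)
  have chi_contr: "chi (H_contr A) (- x) =
      (\<Sum>C\<in>Pow (E - A). (- 1) ^ card C * (- x) ^ r (A \<union> C))" if A: "A \<subseteq> E" for A
    unfolding chi_def edges_contr[OF A empty_subsetI] \<kappa>_contr_E[OF A empty_subsetI]
    using \<kappa>_contr[OF A] by (intro sum.cong refl) (simp add: r_def)
  \<comment> \<open>These inequalities show that no natural-number subtraction in the exponents
    truncates, so parities can be read off termwise.\<close>
  have chain: "\<kappa> A \<le> \<kappa> B" "\<kappa> D \<le> \<kappa> A" "\<kappa> E \<le> \<kappa> D" "A \<union> (D - A) = D" "\<kappa> A \<le> nv"
      "nv \<le> k * card B + \<kappa> B" "\<kappa> A \<le> k * card (D - A) + \<kappa> D"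
    if "B \<subseteq> A" "A \<subseteq> D" "D \<subseteq> E" for B A D
  proof -
    have "A \<subseteq> E" "D - A \<subseteq> E - A" "B \<subseteq> E" using that by auto
    then show "\<kappa> A \<le> \<kappa> B" "\<kappa> D \<le> \<kappa> A" "\<kappa> E \<le> \<kappa> D" "A \<union> (D - A) = D" "\<kappa> A \<le> nv"
      "nv \<le> k * card B + \<kappa> B"
      using that \<kappa>_mono \<kappa>_le nv_le[of B] by auto
    \<comment> \<open>The lower bound on component counts, applied inside the contraction of
      \<open>A\<close>, which has \<open>\<kappa> A\<close> vertices.\<close>
    show "\<kappa> A \<le> k * card (D - A) + \<kappa> D"
      using num_verts_le_num_comps_on[OF hypergraph_contraction[OF contr assms(2)] _
          contraction_uniform[OF contr unif], of A "D - A"]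
        edges_contr[OF \<open>A \<subseteq> E\<close> empty_subsetI] \<kappa>_contr[OF \<open>A \<subseteq> E\<close> \<open>D - A \<subseteq> E - A\<close>]
        nv_contr[OF \<open>A \<subseteq> E\<close> empty_subsetI] \<open>A \<subseteq> E\<close> \<open>D - A \<subseteq> E - A\<close> that
      by (simp add: Un_absorb1)
  qed
  have "tutte_HG H (x + 1) (y + 1) =
      (\<Sum>A\<in>Pow E. tutte_HG (restrict_edges H A) 0 (y + 1) * tutte_HG (H_contr A) (x + 1) 0)"
    if k: "odd k"
  proof -
    have "(\<Sum>A\<in>Pow E. (\<Sum>B\<in>Pow A. (- 1) ^ (\<kappa> B - \<kappa> A) * y ^ n B) * (\<Sum>C\<in>Pow (E - A).
        x ^ r (A \<union> C) * (- 1) ^ (k * card C + \<kappa> (A \<union> C) - \<kappa> A))) = (\<Sum>D\<in>Pow E. s D D)"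
    proof (rule sum_chains_collapse[OF fin, where s = s])
      fix B A D assume BAD: "B \<subseteq> A" "A \<subseteq> D" "D \<subseteq> E"
      note c = chain[OF BAD]
      \<comment> \<open>The two copies of \<open>\<kappa> A\<close> cancel modulo 2, and for odd
        \<open>k\<close> the term \<open>k * card (D - A)\<close> has the parity of
        \<open>card (D - A)\<close>.\<close>
      have "(- 1 :: 'r) ^ ((\<kappa> B - \<kappa> A) + (k * card (D - A) + \<kappa> D - \<kappa> A)) =
          (- 1) ^ (\<kappa> B + \<kappa> D + card (D - A))"
        using c k by (intro neg_one_power_cong) auto
      then show "(- 1) ^ (\<kappa> B - \<kappa> A) * y ^ n B *
          (x ^ r (A \<union> (D - A)) * (- 1) ^ (k * card (D - A) + \<kappa> (A \<union> (D - A)) - \<kappa> A)) =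
          s B D * (- 1) ^ card (D - A)"
        unfolding c(4) s_def by (simp only: power_add ac_simps)
    qed
    then show ?thesis unfolding T by (simp add: T_restr T_contr)
  qed
  moreover have "tutte_HG H (x + 1) (y + 1) =
      (\<Sum>A\<in>Pow E. (- 1) ^ (num_verts H - num_comps_on H A) *
         chi_star k (restrict_edges H A) (- y) * tutte_HG (H_contr A) (x + 1) 0)"
    if k: "even k"
  proof -
    have "(\<Sum>A\<in>Pow E. (\<Sum>B\<in>Pow A. (- 1) ^ (nv - \<kappa> A) * ((- 1) ^ card (A - B) * (- y) ^ n B)) *
        (\<Sum>C\<in>Pow (E - A). x ^ r (A \<union> C) * (- 1) ^ (k * card C + \<kappa> (A \<union> C) - \<kappa> A))) =
        (\<Sum>D\<in>Pow E. (- 1) ^ card (D - D) * s D D)"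
    \<comment> \<open>For even \<open>k\<close> the Tutte factor yields no sign in
      \<open>card (D - A)\<close>. It comes from \<open>card (A - B)\<close> in
      \<open>chi_star\<close>, which is \<open>card (D - B) - card (D - A)\<close>; the extra sign
      in \<open>card (D - B)\<close> is 1 on the diagonal.\<close>
    proof (rule sum_chains_collapse[OF fin, where s = "\<lambda>B D. (- 1) ^ card (D - B) * s B D"])
      fix B A D assume BAD: "B \<subseteq> A" "A \<subseteq> D" "D \<subseteq> E"
      note c = chain[OF BAD]
      have "finite D" using BAD fin finite_subset by blast
      then have "card (D - B) = card (D - A) + card (A - B)"
        using BAD by (subst card_Un_disjoint[symmetric]) (auto intro: finite_subset arg_cong[where f = card])
      then have "(- 1 :: 'r) ^ ((nv - \<kappa> A) + card (A - B) + n B + (k * card (D - A) + \<kappa> D - \<kappa> A)) =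
          (- 1) ^ (card (D - B) + (\<kappa> B + \<kappa> D) + card (D - A))"
        using c k by (intro neg_one_power_cong) (auto simp: n_def)
      then show "(- 1) ^ (nv - \<kappa> A) * ((- 1) ^ card (A - B) * (- y) ^ n B) *
          (x ^ r (A \<union> (D - A)) * (- 1) ^ (k * card (D - A) + \<kappa> (A \<union> (D - A)) - \<kappa> A)) =
          (- 1) ^ card (D - B) * s B D * (- 1) ^ card (D - A)"
        unfolding c(4) s_def power_minus[of y] by (simp only: power_add ac_simps)
    qed
    then show ?thesis unfolding T
      by (simp add: chi_star_restr T_contr sum_distrib_left \<kappa>_def nv_def)
  qed
  moreover have "tutte_HG H (x + 1) (y + 1) =
      (\<Sum>A\<in>Pow E. (- 1) ^ (num_verts (H_contr A) - num_comps (H_contr A)) *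
         tutte_HG (restrict_edges H A) 0 (y + 1) * chi (H_contr A) (- x))"
  proof -
    have "(\<Sum>A\<in>Pow E. (\<Sum>B\<in>Pow A. (- 1) ^ (\<kappa> A - \<kappa> E) * ((- 1) ^ (\<kappa> B - \<kappa> A) * y ^ n B)) *
        (\<Sum>C\<in>Pow (E - A). (- 1) ^ card C * (- x) ^ r (A \<union> C))) = (\<Sum>D\<in>Pow E. s D D)"
    proof (rule sum_chains_collapse[OF fin, where s = s])
      fix B A D assume BAD: "B \<subseteq> A" "A \<subseteq> D" "D \<subseteq> E"
      note c = chain[OF BAD]
      \<comment> \<open>Now \<open>chi\<close> itself supplies the sign in
        \<open>card (D - A)\<close>. The prefactor cancels \<open>\<kappa> A\<close> and, together
        with the sign of \<open>(- x) ^ r D\<close>, also \<open>\<kappa> E\<close>.\<close>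
      have "(- 1 :: 'r) ^ ((\<kappa> A - \<kappa> E) + (\<kappa> B - \<kappa> A) + card (D - A) + r D) =
          (- 1) ^ (\<kappa> B + \<kappa> D + card (D - A))"
        using c by (intro neg_one_power_cong) (auto simp: r_def)
      then show "(- 1) ^ (\<kappa> A - \<kappa> E) * ((- 1) ^ (\<kappa> B - \<kappa> A) * y ^ n B) *
          ((- 1) ^ card (D - A) * (- x) ^ r (A \<union> (D - A))) = s B D * (- 1) ^ card (D - A)"
        unfolding c(4) s_def power_minus[of x] by (simp only: power_add ac_simps)
    qed
    then show ?thesis unfolding T
      by (simp add: T_restr chi_contr sum_distrib_left
          nv_contr[OF _ empty_subsetI] \<kappa>_contr_E[OF _ empty_subsetI])
  qed
  ultimately show ?thesis by (simp add: E_def)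
qed

end
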